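(* For every integer $n \geq 1$, the following identity of polynomials in the indeterminate $x$ holds: $$\sum_{k=1}^n\frac{1}{n}\binom{n}{k}\binom{n}{k-1}x^{k-1}=\sum_{k=0}^{\lfloor (n-1)/2\rfloor}C_k\binom{n-1}{2k}x^k(1+x)^{n-2k-1}.$$
   Context: $C_k=\frac{1}{k+1}\binom{2k}{k}$ denotes the $k$-th Catalan number. *)

theory Defs
  imports Complex_Main "HOL-Computational_Algebra.Polynomial"
begin

definition catalan :: "nat \<Rightarrow> rat" where
  "catalan k = 1 / of_nat (k + 1) * of_nat ((2 * k) choose k)"

end

theory Submission
  imports Defs
begin

text \<open>Compare the coefficients of \<open>x\<^sup>j\<close>. Writing out factorials,
  the \<open>k\<close>-th term on the right contributes \<open>1/n\<close> times
  \<open>(n choose j) (j choose k) (n - j choose k + 1)\<close>, and summing over \<open>k\<close> by Vandermonde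
  gives \<open>1/n (n choose j) (n choose j + 1)\<close>.\<close>

text \<open>Vandermonde for choosing \<open>Suc a\<close> out of \<open>a + b\<close>: the term that
  takes nothing from \<open>b\<close> contains \<open>a choose Suc a = 0\<close>, and the symmetry
  of \<open>a choose _\<close> reverses the other factor.\<close>

lemma choose_convolution_shift:
  fixes a b :: nat
  shows "(\<Sum>k\<le>a. (a choose k) * (b choose Suc k)) = (a + b) choose Suc a"
proof -
  have "(a + b) choose Suc a = (\<Sum>i\<le>Suc a. (b choose i) * (a choose (Suc a - i)))"
    by (simp add: vandermonde add.commute)
  also have "\<dots> = (\<Sum>i\<le>a. (b choose Suc i) * (a choose (a - i)))"
    by (subst sum.atMost_Suc_shift) simp
  also have "\<dots> = (\<Sum>i\<le>a. (a choose i) * (b choose Suc i))"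
    by (intro sum.cong refl) (simp add: binomial_symmetric[symmetric])
  finally show ?thesis ..
qed

lemma catalan_eq_fact: "catalan k = fact (2 * k) / (fact k * fact (Suc k))"
  by (simp add: catalan_def binomial_fact mult_2 field_simps)

text \<open>With \<open>m = n - 1\<close>, the left side is the coefficient of \<open>x^j\<close> in
  the \<open>k\<close>-th term of the right-hand polynomial. The guard \<open>j < k\<close> is
  needed because truncated subtraction would turn \<open>j - k\<close> into 0 and the binomial into
  1.\<close>

lemma catalan_mult_choose:
  "catalan k * of_nat (m choose (2 * k)) * (if j < k then 0 else of_nat ((m - 2 * k) choose (j - k)))
   = of_nat (Suc m choose j) * of_nat ((j choose k) * ((Suc m - j) choose Suc k)) / of_nat (Suc m)"
\<comment> \<open>In this range, with \<open>a = j - k\<close> and \<open>b = m - j - k\<close>,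
  both sides equal \<open>m! / (k! (k+1)! a! b!)\<close>; outside it both vanish.\<close>
proof (cases "k \<le> j \<and> j + k \<le> m")
  case True
  then obtain a where a: "j = k + a" using le_Suc_ex by blast
  with True obtain b where b: "m = 2 * k + a + b" using le_Suc_ex[of "j + k" m] by auto
  have eqs: "m - 2 * k = a + b" "j - k = a" "Suc m - j = Suc k + b"
    using a b by auto
  have e1: "of_nat (m choose (2 * k)) = (fact m / (fact (2 * k) * fact (a + b)) :: rat)"
    using b by (simp add: binomial_fact)
  have e2: "of_nat ((a + b) choose a) = (fact (a + b) / (fact a * fact b) :: rat)"
    by (simp add: binomial_fact)
  have e3: "of_nat (Suc m choose j) = (fact (Suc m) / (fact j * fact (Suc k + b)) :: rat)"
    using binomial_fact[of j "Suc m", where 'a = rat] eqs(3) True by simp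
  have e4: "of_nat (j choose k) = (fact j / (fact k * fact a) :: rat)"
    using a by (simp add: binomial_fact)
  have e5: "of_nat ((Suc k + b) choose Suc k)
      = (fact (Suc k + b) / (fact (Suc k) * fact b) :: rat)"
    using binomial_fact[of "Suc k" "Suc k + b", where 'a = rat] by simp
  have e6: "fact (Suc m) = (of_nat (Suc m) * fact m :: rat)"
    by (rule fact_Suc)
  have nz: "of_nat (Suc m) \<noteq> (0 :: rat)" by (rule of_nat_neq_0)
  have jk: "(j < k) = False" using True by simp
  show ?thesis
    unfolding catalan_eq_fact eqs of_nat_mult e1 e2 e3 e4 e5 e6 jk if_False
    using nz by (simp del: fact_Suc of_nat_Suc)
next
  case False
  have "m choose (2 * k) = 0 \<or> (m - 2 * k) choose (j - k) = 0" if "k \<le> j"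
    using False that by (auto simp: binomial_eq_0_iff)
  moreover have "j choose k = 0 \<or> (Suc m - j) choose Suc k = 0"
    using False by (auto simp: binomial_eq_0_iff)
  ultimately show ?thesis by (auto simp: not_less simp del: of_nat_Suc binomial_Suc_Suc binomial_eq_0_iff)
qed

theorem theorem1:
  fixes n :: nat
  assumes "n \<ge> 1"
  shows "(\<Sum>k = 1..n. smult (1 / of_nat n * of_nat (n choose k) * of_nat (n choose (k - 1)))
                          ([:0, 1:] ^ (k - 1)))
       = (\<Sum>k = 0..(n - 1) div 2. smult (catalan k * of_nat ((n - 1) choose (2 * k)))
                          ([:0, 1:] ^ k * (1 + [:0, 1:]) ^ (n - 2 * k - 1)))"
  (is "?L = ?R")
proof (rule poly_eqI)
  fix j
  obtain m where n: "n = Suc m" using assms by (cases n) auto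
  have X: "[:0, 1:] ^ k = (monom 1 k :: rat poly)" for k
    by (simp add: monom_altdef)
  let ?c = "\<lambda>k. of_nat (n choose Suc k) * of_nat (n choose k) / of_nat n :: rat"
  let ?t = "\<lambda>k. of_nat (n choose j) * of_nat ((j choose k) * ((n - j) choose Suc k)) / of_nat n :: rat"
  have "coeff ?L j = coeff (\<Sum>k\<le>m. monom (?c k) k) j"
    unfolding X n One_nat_def sum.shift_bounds_cl_Suc_ivl atLeast0AtMost
    by (simp add: smult_monom del: binomial_Suc_Suc of_nat_Suc)
  \<comment> \<open>For \<open>j > m\<close> the coefficient is 0, and so is \<open>?c j\<close>,
    since then \<open>n choose Suc j = 0\<close>.\<close>
  also have "\<dots> = ?c j"
    by (auto simp: coeff_sum n binomial_eq_0_iff simp del: binomial_Suc_Suc of_nat_Suc)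
  also have "\<dots> = (\<Sum>k\<le>j. ?t k)"
  proof (cases "j \<le> n")
    case True
    then have "(\<Sum>k\<le>j. (j choose k) * ((n - j) choose Suc k)) = n choose Suc j"
      using choose_convolution_shift[of j "n - j"] by simp
    then show ?thesis
      by (simp only: sum_divide_distrib[symmetric] sum_distrib_left[symmetric]
          of_nat_sum[symmetric] mult.commute)
  qed (simp add: binomial_eq_0)
  \<comment> \<open>The bound \<open>j + m\<close> covers both ranges \<open>k \<le> j\<close> and
    \<open>k \<le> m div 2\<close>; the terms added here vanish by
    \<open>j choose k = 0\<close>.\<close>
  also have "\<dots> = (\<Sum>k\<le>j + m. ?t k)"
    by (rule sum.mono_neutral_left) (auto simp: binomial_eq_0)
  also have "\<dots> = (\<Sum>k\<le>m div 2. ?t k)"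
  proof (rule sum.mono_neutral_right)
    show "\<forall>k\<in>{..j + m} - {..m div 2}. ?t k = 0"
    proof
      fix k assume "k \<in> {..j + m} - {..m div 2}"
      then have "m choose (2 * k) = 0" by (auto simp: binomial_eq_0_iff)
      \<comment> \<open>The zero factor \<open>m choose (2 * k)\<close> is not visible in
        \<open>?t k\<close>; it is carried over from the Catalan form of the term.\<close>
      then show "?t k = 0" using catalan_mult_choose[of k m j] by (simp only: n)
    qed
  qed auto
  also have "\<dots> = coeff ?R j"
  proof -
    \<comment> \<open>Needed for all \<open>i\<close>: beyond \<open>p\<close>, the degree bound
      makes the coefficient 0, like the binomial.\<close>
    have "coeff ((1 + [:0, 1:]) ^ p) i = (of_nat (p choose i) :: rat)" for p i
    proof (cases "i \<le> p")
      case True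
      then show ?thesis
        using coeff_linear_poly_power[of i p "1 :: rat" 1] by (simp add: one_pCons)
    next
      case False
      have "degree ((1 + [:0, 1 :: rat:]) ^ p) \<le> p"
        using degree_power_le[of "1 + [:0, 1 :: rat:]" p] by (simp add: one_pCons)
      with False show ?thesis by (simp add: coeff_eq_0 binomial_eq_0)
    qed
    then have "coeff (monom 1 k * (1 + [:0, 1:]) ^ (n - 2 * k - 1)) j
        = (if j < k then 0 else of_nat ((m - 2 * k) choose (j - k)) :: rat)" for k
      by (simp add: coeff_monom_mult n not_less)
    then show ?thesis
      unfolding X coeff_sum coeff_smult atLeast0AtMost
      using catalan_mult_choose[of _ m j] by (simp only: n diff_Suc_1)
  qed
  finally show "coeff ?L j = coeff ?R j" .
qed

end
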